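(* For every integer $n\ge 1$, let $C_o(n)$ denote the number of integer compositions of $n$ whose first part is odd, and let $C_e(n)$ denote the number of integer compositions of $n$ whose first part is even. For $m\ge 0$ let $G(m)$ denote the number of closed walks of length $m$ on a triangle (the complete graph on three vertices) starting from (and ending at) a fixed chosen vertex. Then $$C_o(n)-C_e(n)=G(n-1).$$
   Context: An integer composition of a positive integer $n$ is a finite sequence of positive integers with sum $n$ (the order of the parts matters). A walk of length $m$ on a graph is a sequence of $m+1$ vertices in which consecutive vertices are adjacent; it is closed if its first and last vertices coincide. *)

theory Defs
  imports Complex_Main "Graph_Theory.Kuratowski" "Graph_Theory.Vertex_Walk"
begin

definition compositions :: "nat \<Rightarrow> nat list set" where
  "compositions n = {xs. (\<forall>x\<in>set xs. x > 0) \<and> sum_list xs = n}"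

text \<open>The condition \<open>xs \<noteq> []\<close> holds automatically for \<open>n \<ge> 1\<close>; it only excludes
  the empty composition of \<open>0\<close>, which has no first part.\<close>

definition C_odd :: "nat \<Rightarrow> nat" where
  "C_odd n = card {xs \<in> compositions n. xs \<noteq> [] \<and> odd (hd xs)}"

definition C_even :: "nat \<Rightarrow> nat" where
  "C_even n = card {xs \<in> compositions n. xs \<noteq> [] \<and> even (hd xs)}"

text \<open>Undirected graphs are symmetric digraphs here, and a walk is its nonempty list of vertices;
  \<^const>\<open>vwalk_length\<close> counts steps, so a walk of length \<open>m\<close> has \<open>m + 1\<close> entries.\<close>

definition closed_walks :: "('a, 'b) pre_digraph \<Rightarrow> 'a \<Rightarrow> nat \<Rightarrow> 'a vwalk set" where
  "closed_walks G v m = {p. vwalk p G \<and> vwalk_length p = m \<and> hd p = v \<and> last p = v}"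

lemma finite_compositions: "finite (compositions n)"
proof (rule finite_subset)
  have "length xs \<le> sum_list xs" if "\<forall>x\<in>set xs. x > 0" for xs :: "nat list"
    using that by (induction xs) auto
  then show "compositions n \<subseteq> {xs. set xs \<subseteq> {..n} \<and> length xs \<le> n}"
    by (auto simp: compositions_def member_le_sum_list)
  show "finite {xs. set xs \<subseteq> {..n} \<and> length xs \<le> n}"
    by (rule finite_lists_length_le) simp
qed

lemma finite_closed_walks:
  assumes "finite (verts G)"
  shows "finite (closed_walks G v m)"
proof (rule finite_subset)
  show "closed_walks G v m \<subseteq> {p. set p \<subseteq> verts G \<and> length p \<le> Suc m}"
    by (auto simp: closed_walks_def vwalk_def)
  show "finite {p. set p \<subseteq> verts G \<and> length p \<le> Suc m}"
    using assms by (rule finite_lists_length_le)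
qed

end

(* Incrementing the first part of a composition flips its parity, and prepending a part 1
   accounts for the remaining compositions, so C_e(n+1) = C_o(n) and C_o(n+1) = C_o(n) + 2 C_e(n).
   Let a(m), b(m) count the walks of length m on the triangle that end at v and start at v,
   respectively at another vertex; splitting off the first step gives a(m+1) = 2 b(m) and
   b(m+1) = a(m) + b(m). Hence a(m) = C_o(m+1) - C_e(m+1) and b(m) = C_e(m+1) by simultaneous
   induction. *)
theory Submission
  imports Defs
begin

definition increment_hd :: "nat list \<Rightarrow> nat list" where
  "increment_hd xs = Suc (hd xs) # tl xs"

text \<open>\<open>[]\<close> must be excluded: its image coincides with that of
  \<open>[hd []]\<close>.\<close>

lemma inj_on_increment_hd: "inj_on increment_hd (- {[]})"
  by (auto simp: inj_on_def increment_hd_def intro: list.expand)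

text \<open>A first part above 1 can be decremented, and a first part equal to 1 can be deleted.
  Keeping \<open>P\<close> abstract lets one decomposition serve both parities.\<close>

lemma compositions_Suc_eq:
  assumes "n \<ge> 1"
  shows "{xs \<in> compositions (Suc n). xs \<noteq> [] \<and> P (hd xs)} =
    increment_hd ` {xs \<in> compositions n. xs \<noteq> [] \<and> P (Suc (hd xs))} \<union>
    (if P 1 then Cons 1 ` compositions n else {})" (is "?L = ?A \<union> ?B")
proof (intro subset_antisym subsetI)
  fix xs assume "xs \<in> ?L"
  then obtain x ys where xs: "xs = x # ys" "x > 0" "P x" "\<forall>y\<in>set ys. y > 0" "x + sum_list ys = Suc n"
    by (cases xs) (auto simp: compositions_def)
  show "xs \<in> ?A \<union> ?B"
  proof (cases "x = 1")
    case True
    then show ?thesis using xs by (auto simp: compositions_def)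
  next
    case False
    then have "xs = increment_hd ((x - 1) # ys)" "(x - 1) # ys \<in> compositions n" "P (Suc (x - 1))"
      using xs by (auto simp: increment_hd_def compositions_def)
    then show ?thesis by auto
  qed
next
  fix xs assume "xs \<in> ?A \<union> ?B"
  then show "xs \<in> ?L"
  proof
    assume "xs \<in> ?A"
    then obtain ys where "xs = increment_hd ys" "ys \<in> compositions n" "ys \<noteq> []" "P (Suc (hd ys))"
      by auto
    then show ?thesis
      by (cases ys) (auto simp: increment_hd_def compositions_def)
  next
    assume "xs \<in> ?B"
    then show ?thesis
      by (auto simp: compositions_def split: if_splits)
  qed
qed

lemma card_compositions:
  assumes "n \<ge> 1"
  shows "card (compositions n) = C_odd n + C_even n"
proof -
  have "compositions n = {xs \<in> compositions n. xs \<noteq> [] \<and> odd (hd xs)} \<union>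
      {xs \<in> compositions n. xs \<noteq> [] \<and> even (hd xs)}"
    \<comment> \<open>\<open>n \<ge> 1\<close> rules out the empty composition, which lies in
      neither class.\<close>
    using assms by (auto simp: compositions_def)
  also have "card \<dots> = C_odd n + C_even n"
    unfolding C_odd_def C_even_def
    by (rule card_Un_disjoint) (auto simp: finite_compositions)
  finally show ?thesis .
qed

lemma card_increment_hd_image:
  "card (increment_hd ` {xs \<in> A. xs \<noteq> [] \<and> P xs}) = card {xs \<in> A. xs \<noteq> [] \<and> P xs}"
  by (rule card_image, rule inj_on_subset[OF inj_on_increment_hd]) auto

text \<open>Since 1 is odd, only the incremented compositions contribute.\<close>

lemma C_even_Suc:
  assumes "n \<ge> 1"
  shows "C_even (Suc n) = C_odd n"
  using compositions_Suc_eq[OF assms, of even]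
  by (simp add: C_even_def C_odd_def card_increment_hd_image)

lemma C_odd_Suc:
  assumes "n \<ge> 1"
  shows "C_odd (Suc n) = C_odd n + 2 * C_even n"
proof -
  let ?A = "increment_hd ` {xs \<in> compositions n. xs \<noteq> [] \<and> even (hd xs)}"
  \<comment> \<open>Parts are positive, so an incremented first part is at least 2.\<close>
  have "?A \<inter> Cons 1 ` compositions n = {}"
    by (auto simp: increment_hd_def compositions_def) (metis hd_in_set less_irrefl)
  then have "card (?A \<union> Cons 1 ` compositions n) = card ?A + card (Cons (1::nat) ` compositions n)"
    by (intro card_Un_disjoint) (auto simp: finite_compositions)
  also have "card (Cons (1::nat) ` compositions n) = C_odd n + C_even n"
    using card_compositions[OF assms] by (simp add: card_image)
  finally show ?thesis
    using compositions_Suc_eq[OF assms, of odd]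
    by (simp add: C_odd_def C_even_def card_increment_hd_image)
qed

lemma compositions_1: "compositions 1 = {[1]}"
proof (intro subset_antisym subsetI)
  fix xs assume "xs \<in> compositions 1"
  then obtain x ys where xs: "xs = x # ys" "x > 0" "\<forall>y\<in>set ys. y > 0" "x + sum_list ys = 1"
    by (cases xs) (auto simp: compositions_def)
  moreover from this have "ys = []"
    by (cases ys) auto
  ultimately show "xs \<in> {[1]}"
    by simp
qed (simp add: compositions_def)

lemma C_odd_1: "C_odd 1 = 1" and C_even_1: "C_even 1 = 0"
proof -
  have "{xs \<in> compositions 1. xs \<noteq> [] \<and> odd (hd xs)} = {[1]}"
    and "{xs \<in> compositions 1. xs \<noteq> [] \<and> even (hd xs)} = {}"
    unfolding compositions_1 by auto
  then show "C_odd 1 = 1" "C_even 1 = 0"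
    by (simp_all only: C_odd_def C_even_def) simp_all
qed

text \<open>Splitting off the first step moves the start but keeps the end, so the recursion needs
  walks with distinct endpoints.\<close>

definition walks :: "('a, 'b) pre_digraph \<Rightarrow> 'a \<Rightarrow> 'a \<Rightarrow> nat \<Rightarrow> 'a vwalk set" where
  "walks G u v m = {p. vwalk p G \<and> vwalk_length p = m \<and> hd p = u \<and> last p = v}"

lemma closed_walks_eq_walks: "closed_walks G v m = walks G v v m"
  by (simp add: closed_walks_def walks_def)

lemma finite_walks:
  assumes "finite (verts G)"
  shows "finite (walks G u v m)"
proof (rule finite_subset)
  show "walks G u v m \<subseteq> {p. set p \<subseteq> verts G \<and> length p \<le> Suc m}"
    by (auto simp: walks_def vwalk_def)
  show "finite {p. set p \<subseteq> verts G \<and> length p \<le> Suc m}"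
    using assms by (rule finite_lists_length_le)
qed

lemma walks_0:
  assumes "u \<in> verts G"
  shows "walks G u v 0 = (if u = v then {[u]} else {})"
proof -
  \<comment> \<open>The empty list has no steps either, but \<open>vwalk\<close> excludes
    it.\<close>
  have "p = [hd p]" if "p \<in> walks G u v 0" for p
    using that by (cases p) (auto simp: walks_def vwalk_def)
  then show ?thesis
    using assms by (auto simp: walks_def vwalk_def) (metis last.simps)+
qed

lemma (in wf_digraph) walks_Suc:
  "walks G u v (Suc m) = (\<Union>w\<in>{w. (u, w) \<in> arcs_ends G}. Cons u ` walks G w v m)"
proof (intro subset_antisym subsetI)
  fix p assume p: "p \<in> walks G u v (Suc m)"
  \<comment> \<open>A walk with at least one step has at least two entries.\<close>
  then obtain w q where "p = u # w # q"
    by (cases p rule: vwalk_arcs.cases) (auto simp: walks_def vwalk_def)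
  with p show "p \<in> (\<Union>w\<in>{w. (u, w) \<in> arcs_ends G}. Cons u ` walks G w v m)"
    by (auto simp: walks_def vwalk_def)
next
  fix p assume "p \<in> (\<Union>w\<in>{w. (u, w) \<in> arcs_ends G}. Cons u ` walks G w v m)"
  then obtain w q where q: "(u, w) \<in> arcs_ends G" "p = u # q" "q \<in> walks G w v m"
    by auto
  then have "u \<in> verts G"
    by auto
  with q show "p \<in> walks G u v (Suc m)"
    by (cases q) (auto simp: walks_def vwalk_def)
qed

lemma (in fin_digraph) card_walks_Suc:
  "card (walks G u v (Suc m)) = (\<Sum>w | (u, w) \<in> arcs_ends G. card (walks G w v m))"
proof -
  have "finite {w. (u, w) \<in> arcs_ends G}"
    by (rule finite_subset[OF _ finite_verts]) auto
  \<comment> \<open>The second vertex of a walk determines \<open>w\<close>.\<close>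
  moreover have "Cons u ` walks G w v m \<inter> Cons u ` walks G w' v m = {}" if "w \<noteq> w'" for w w'
    using that by (auto simp: walks_def)
  ultimately show ?thesis
    unfolding walks_Suc
    by (subst card_UN_disjoint) (auto simp: finite_walks card_image)
qed

text \<open>Both sides obey the same recurrences. The start \<open>u\<close> varies in the
  induction, so the closed and non-closed counts are handled together; \<open>int\<close> avoids
  truncated subtraction.\<close>

lemma card_walks_triangle:
  assumes "complete_digraph 3 T" and "v \<in> verts T" and "u \<in> verts T"
  shows "int (card (walks T u v m)) =
    (if u = v then int (C_odd (Suc m)) - int (C_even (Suc m)) else int (C_even (Suc m)))"
  using assms(3)
proof (induction m arbitrary: u)
  case 0
  then show ?case
    using C_odd_1 C_even_1 by (simp add: walks_0)
next
  case (Suc m)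
  interpret graph T
    using assms(1) by (simp add: complete_digraph_def)
  have nb: "{w. (u, w) \<in> arcs_ends T} = verts T - {u}"
    using assms(1) Suc.prems by (auto simp: complete_digraph_def)
  have card: "card (verts T) = 3"
    using assms(1) by (simp add: complete_digraph_def)
  let ?d = "int (C_odd (Suc m)) - int (C_even (Suc m))" and ?e = "int (C_even (Suc m))"
  have step: "int (card (walks T u v (Suc m))) =
      (\<Sum>w\<in>verts T - {u}. if w = v then ?d else ?e)"
    unfolding card_walks_Suc nb of_nat_sum by (rule sum.cong) (auto simp: Suc.IH)
  show ?case
  proof (cases "u = v")
    case True
    \<comment> \<open>From \<open>v\<close>, the first step leads to one of two vertices other than
      \<open>v\<close>.\<close>
    have "(\<Sum>w\<in>verts T - {u}. if w = v then ?d else ?e) = (\<Sum>w\<in>verts T - {u}. ?e)"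
      using True by (intro sum.cong) auto
    also have "\<dots> = 2 * ?e"
      using card Suc.prems by simp
    finally show ?thesis
      using True step by (simp add: C_odd_Suc C_even_Suc)
  next
    case False
    \<comment> \<open>The neighbours of \<open>u\<close> are \<open>v\<close> and the third vertex;
      \<open>?d + ?e\<close> is then \<open>C_odd (Suc m)\<close>, which equals
      \<open>C_even (Suc (Suc m))\<close>.\<close>
    have "(\<Sum>w\<in>verts T - {u}. if w = v then ?d else ?e) = ?d + (\<Sum>w\<in>verts T - {u} - {v}. ?e)"
      using False assms(2) by (subst sum.remove[of _ v]) (auto intro!: sum.cong)
    also have "\<dots> = ?d + ?e"
      using card Suc.prems assms(2) False by simp
    finally show ?thesis
      using False step by (simp add: C_even_Suc)
  qed
qed

theorem theorem4p11:
  fixes T :: "('a, 'b) pre_digraph" and v :: 'a and n :: nat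
  assumes "complete_digraph 3 T"
    and "v \<in> verts T"
    and "n \<ge> 1"
  shows "int (C_odd n) - int (C_even n) = int (card (closed_walks T v (n - 1)))"
  using card_walks_triangle[OF assms(1,2,2), of "n - 1"] assms(3)
  by (simp add: closed_walks_eq_walks)

end
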